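(* Consider the system $x(t+1)=f(x(t),u(t),\theta)$ with $f$ of class $C^1$ in all arguments, true parameter $\theta\in\Omega_\theta$, where $\Omega_\theta\subset\mathbb{R}^{n_\theta}$ is compact and convex, and target state $x_*\in\mathbb{R}^n$. Assume: (i) (reachability) for every $x\in\mathbb{R}^n$ and every $\xi\in\Omega_\theta$ there exist $N>0$ and an input sequence $u[0,N-1]$ such that $\varphi(N,0,x;u,\xi)=x_*$ and $\operatorname{rank}\frac{\partial\varphi(N,0,x;u,\xi)}{\partial u[0,N-1]}=n$; (ii) (excitation) there exist $N$ and an input sequence $u[0,N-1]$ such that for every $x\in\mathbb{R}^n$ and every $\xi\in\Omega_\theta$, the trajectory $X[0,N;u,\xi]$ started at $x(0)=x$ satisfies $\operatorname{rank}\frac{\partial X[0,N;u,\xi]}{\partial\xi}=n_\theta$; (iii) for each $x\in\mathbb{R}^n$, constants $N_x>0$ and $\rho_x>0$ are known a priori such that for every $\xi\in\Omega_\theta$ there exist $N\le N_x$ and $u[0,N-1]\in\overline{B}^{\infty}(0,\rho_x)$ with $\varphi(N,0,x;u,\xi)=x_*$. Then, for any initial state $x(0)$ and any constants $0<\beta<1$, $\mu_0>0$, $\kappa_0>0$, $\varepsilon_{\mathrm{fin}}>0$, the adaptive set-point regulation algorithm described in the context terminates after finitely many iterations (whichever admissible approximate solutions are selected), and the state of the system reaches the neighborhood $B(x_*,\varepsilon_{\mathrm{fin}})$ of the target state $x_*$.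
   Context: Notation. The system is $x(t+1)=f(x(t),u(t),\theta)$, $t\in\mathbb{N}=\{0,1,2,\dots\}$, with state $x(t)\in\mathbb{R}^n$, input $u(t)\in\mathbb{R}^{n_u}$ and parameter in $\mathbb{R}^{n_\theta}$; $\theta\in\Omega_\theta$ denotes the true (unknown, to be estimated) parameter that generates the actual state trajectory. $u[t_0,t_1]$ denotes the sequence $(u(t_0),\dots,u(t_1))$, sometimes identified with a vector in $\mathbb{R}^{n_u(t_1-t_0+1)}$. For a parameter value $\xi$, $\varphi(t_1,t_0,x;u,\xi)$ denotes the solution at time $t_1$ of $z(t+1)=f(z(t),u(t),\xi)$ with $z(t_0)=x$, and $X[t_0,t_1;u,\xi]$ denotes the corresponding sequence of states from time $t_0$ to time $t_1$, identified with a vector in $\mathbb{R}^{n(t_1-t_0+1)}$. $B(x,\rho)$ and $\overline{B}(x,\rho)$ are the open and closed balls with center $x$ and radius $\rho$. $\overline{B}^{\infty}(0,\rho)$ is the set of input sequences $v[t_0,t_1]$ with $v(t)\in\overline{B}(0,\rho)$ for all $t\in\{t_0,\dots,t_1\}$. Given times $0=T_0<T_1<T_2<\cdots$, the initial state $x(0)$ and the inputs applied so far, define for a parameter value $\xi$ $$g_k(\xi)=\big(\varphi(1,0,x(0);u,\xi)^T,\dots,\varphi(T_k,0,x(0);u,\xi)^T\big)^T ,\qquad h_k(\xi)=\varphi(T_k+N_k,T_k,x(T_k);u,\xi),$$ where $x(T_k)$ is the actual state at time $T_k$. Thus $g_k(\theta)$ is the vector of actual states $x(1),\dots,x(T_k)$.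 Algorithm. Initialization: given $x(0)$, choose constants $0<\beta<1$, $\mu_0>0$, $\kappa_0>0$, $\varepsilon_{\mathrm{fin}}>0$. Let $u[0,N_0-1]$ be an excitation signal, i.e. a sequence as in hypothesis (ii) with $N=N_0$; set $T_0=0$, $T_1=N_0$, $k=1$; apply $u[0,N_0-1]$ to the actual system (parameter $\theta$) to obtain $x(T_1)$. Loop: If $\|x(T_k)-x_*\|<\varepsilon_{\mathrm{fin}}$, break (terminate). Otherwise: - set $\mu=\beta\mu_{k-1}$ and $\kappa_k=\kappa_{k-1}/\beta$; - (inner while loop) repeat the following: (a) obtain $\theta_k\in\Omega_\theta$ with $\|g_k(\theta_k)-g_k(\theta)\|<\mu$ (any such $\theta_k$); (b) obtain $N_k$ and $u[T_k,T_k+N_k-1]$ (any such choice) with $N_k\le N_{x(T_k)}$, $u[T_k,T_k+N_k-1]\in\overline{B}^{\infty}(0,\rho_{x(T_k)})$ and $\|h_k(\theta_k)-x_*\|<\varepsilon_{\mathrm{fin}}/2$; (c) if $h_k(B(\theta_k,\kappa_k\mu))\subset B(h_k(\theta_k),\varepsilon_{\mathrm{fin}}/2)$, set $\mu_k=\mu$ and leave the inner while loop; otherwise replace $\mu$ by $\beta\mu$ and repeat from (a); - let $T_{k+1}=T_k+N_k$; - apply $u[T_k,T_k+N_k-1]$ to the actual system (parameter $\theta$) to obtain $x(T_{k+1})$; - replace $k$ by $k+1$ and repeat the outer loop. *)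

theory Defs
  imports "HOL-Analysis.Analysis"
begin

definition C1_map :: "('a::euclidean_space \<Rightarrow> 'b::euclidean_space) \<Rightarrow> bool" where
  "C1_map F \<longleftrightarrow>
     (\<exists>F' :: 'a \<Rightarrow> 'a \<Rightarrow>\<^sub>L 'b.
        (\<forall>z. (F has_derivative blinfun_apply (F' z)) (at z)) \<and> continuous_on UNIV F')"

text \<open>
  Input sequences are total functions on the naturals; the solution at time \<open>t1\<close> started at time
  \<open>t0\<close> only reads the inputs at times \<open>t0, \<dots>, t1 - 1\<close>, so the other values are irrelevant.
  For \<open>t1 \<le> t0\<close> the value is the initial state; only \<open>t1 \<ge> t0\<close> is meaningful.
\<close>

primrec sol ::
  "('s \<Rightarrow> 'u \<Rightarrow> 'q \<Rightarrow> 's) \<Rightarrow> nat \<Rightarrow> nat \<Rightarrow> 's \<Rightarrow> (nat \<Rightarrow> 'u) \<Rightarrow> 'q \<Rightarrow> 's" where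
  "sol f 0 t0 x u \<xi> = x"
| "sol f (Suc t) t0 x u \<xi> = (if t0 \<le> t then f (sol f t t0 x u \<xi>) (u t) \<xi> else x)"

text \<open>
  The Jacobian of the final state with respect to the input sequence \<open>u[0, N-1]\<close> is the block row
  of its Jacobians with respect to the single inputs \<open>u(t)\<close>, \<open>t < N\<close>. The number of columns depends
  on the value \<open>N\<close>, so the matrix is given by its set of columns; as for matrices of fixed size
  (\<open>column_rank_def\<close>), the rank is the dimension of the column space.
\<close>

definition input_jacobian_columns ::
  "(real^'n \<Rightarrow> real^'m \<Rightarrow> real^'p \<Rightarrow> real^'n) \<Rightarrow> nat \<Rightarrow> real^'n \<Rightarrow> (nat \<Rightarrow> real^'m) \<Rightarrow> real^'p
    \<Rightarrow> (real^'n) set" where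
  "input_jacobian_columns f N x u \<xi> =
     (\<Union>t\<in>{..<N}. columns (jacobian (\<lambda>v. sol f N 0 x (u(t := v)) \<xi>) (at (u t))))"

definition rank_input_jacobian ::
  "(real^'n \<Rightarrow> real^'m \<Rightarrow> real^'p \<Rightarrow> real^'n) \<Rightarrow> nat \<Rightarrow> real^'n \<Rightarrow> (nat \<Rightarrow> real^'m) \<Rightarrow> real^'p
    \<Rightarrow> nat" where
  "rank_input_jacobian f N x u \<xi> = dim (input_jacobian_columns f N x u \<xi>)"

text \<open>
  Dually, the Jacobian of the state sequence \<open>X[0, N]\<close> with respect to the parameter is the block
  column of the Jacobians of the states at times \<open>0, \<dots>, N\<close>; it is given by its set of rows, and
  the rank is the dimension of the row space (\<open>row_rank_def\<close>).
\<close>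

definition param_jacobian_rows ::
  "(real^'n \<Rightarrow> real^'m \<Rightarrow> real^'p \<Rightarrow> real^'n) \<Rightarrow> nat \<Rightarrow> real^'n \<Rightarrow> (nat \<Rightarrow> real^'m) \<Rightarrow> real^'p
    \<Rightarrow> (real^'p) set" where
  "param_jacobian_rows f N x u \<xi> =
     (\<Union>t\<in>{..N}. rows (jacobian (\<lambda>\<zeta>. sol f t 0 x u \<zeta>) (at \<xi>)))"

definition rank_param_jacobian ::
  "(real^'n \<Rightarrow> real^'m \<Rightarrow> real^'p \<Rightarrow> real^'n) \<Rightarrow> nat \<Rightarrow> real^'n \<Rightarrow> (nat \<Rightarrow> real^'m) \<Rightarrow> real^'p
    \<Rightarrow> nat" where
  "rank_param_jacobian f N x u \<xi> = dim (param_jacobian_rows f N x u \<xi>)"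

definition exciting ::
  "(real^'n \<Rightarrow> real^'m \<Rightarrow> real^'p \<Rightarrow> real^'n) \<Rightarrow> (real^'p) set \<Rightarrow> nat \<Rightarrow> (nat \<Rightarrow> real^'m) \<Rightarrow> bool" where
  "exciting f \<Omega> N u \<longleftrightarrow> (\<forall>x. \<forall>\<xi>\<in>\<Omega>. rank_param_jacobian f N x u \<xi> = CARD('p))"

text \<open>
  Euclidean norm of \<open>g(\<xi>) - g(\<theta>)\<close>, where \<open>g(\<xi>)\<close> stacks the states predicted with parameter \<open>\<xi>\<close>
  at times \<open>1, \<dots>, T\<close> from the initial state \<open>x0\<close>.
\<close>

definition output_error ::
  "('s::real_normed_vector \<Rightarrow> 'u \<Rightarrow> 'q \<Rightarrow> 's) \<Rightarrow> 'q \<Rightarrow> 's \<Rightarrow> nat \<Rightarrow> (nat \<Rightarrow> 'u) \<Rightarrow> 'q \<Rightarrow> real" where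
  "output_error f \<theta> x0 T u \<xi> = L2_set (\<lambda>t. norm (sol f t 0 x0 u \<xi> - sol f t 0 x0 u \<theta>)) {1..T}"

text \<open>
  The algorithm is a nondeterministic transition system. Each configuration carries the current
  time \<open>T\<close> (that is, \<open>T\<^sub>k\<close>) and the input history \<open>u\<close>, relevant on \<open>{0..<T}\<close>, which determine the
  actual state \<open>sol f T 0 x0 u \<theta>\<close>. The iteration index itself is never used and is not stored.
  \<^item> \<open>Outer T u \<mu> \<kappa>\<close>: top of the outer loop, with \<open>\<mu> = \<mu>\<^sub>k\<^sub>-\<^sub>1\<close> and \<open>\<kappa> = \<kappa>\<^sub>k\<^sub>-\<^sub>1\<close>.
  \<^item> \<open>Estimate T u \<mu> \<kappa>\<close>: about to do (a), with the current \<open>\<mu>\<close> and \<open>\<kappa> = \<kappa>\<^sub>k\<close>.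
  \<^item> \<open>Plan T u \<mu> \<kappa> \<eta>\<close>: about to do (b), with estimate \<open>\<eta> = \<theta>\<^sub>k\<close>.
  \<^item> \<open>Test T u \<mu> \<kappa> \<eta> N w\<close>: about to do (c), with \<open>N = N\<^sub>k\<close>; \<open>w\<close> is the history \<open>u\<close> extended by
    the planned inputs at times \<open>T, \<dots>, T + N - 1\<close>.
  \<^item> \<open>Halted T u\<close>: terminated.
\<close>

datatype ('u, 'q) config =
    Outer nat "nat \<Rightarrow> 'u" real real
  | Estimate nat "nat \<Rightarrow> 'u" real real
  | Plan nat "nat \<Rightarrow> 'u" real real 'q
  | Test nat "nat \<Rightarrow> 'u" real real 'q nat "nat \<Rightarrow> 'u"
  | Halted nat "nat \<Rightarrow> 'u"

inductive alg_step ::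
  "('s::euclidean_space \<Rightarrow> 'u::euclidean_space \<Rightarrow> 'q::euclidean_space \<Rightarrow> 's) \<Rightarrow> 'q \<Rightarrow> 'q set \<Rightarrow>
   's \<Rightarrow> 's \<Rightarrow> ('s \<Rightarrow> nat) \<Rightarrow> ('s \<Rightarrow> real) \<Rightarrow> real \<Rightarrow> real \<Rightarrow>
   ('u, 'q) config \<Rightarrow> ('u, 'q) config \<Rightarrow> bool"
  for f \<theta> \<Omega> x0 xs Nb \<rho> \<beta> \<epsilon>
where
  break:
    "norm (sol f T 0 x0 u \<theta> - xs) < \<epsilon> \<Longrightarrow>
     alg_step f \<theta> \<Omega> x0 xs Nb \<rho> \<beta> \<epsilon> (Outer T u \<mu> \<kappa>) (Halted T u)"
| enter:
    "\<not> norm (sol f T 0 x0 u \<theta> - xs) < \<epsilon> \<Longrightarrow>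
     alg_step f \<theta> \<Omega> x0 xs Nb \<rho> \<beta> \<epsilon> (Outer T u \<mu> \<kappa>) (Estimate T u (\<beta> * \<mu>) (\<kappa> / \<beta>))"
| estimate:
    "\<eta> \<in> \<Omega> \<Longrightarrow> output_error f \<theta> x0 T u \<eta> < \<mu> \<Longrightarrow>
     alg_step f \<theta> \<Omega> x0 xs Nb \<rho> \<beta> \<epsilon> (Estimate T u \<mu> \<kappa>) (Plan T u \<mu> \<kappa> \<eta>)"
| plan:
    "N \<le> Nb (sol f T 0 x0 u \<theta>) \<Longrightarrow>
     \<forall>t<T. w t = u t \<Longrightarrow>
     \<forall>t\<in>{T..<T + N}. w t \<in> cball 0 (\<rho> (sol f T 0 x0 u \<theta>)) \<Longrightarrow>
     norm (sol f (T + N) T (sol f T 0 x0 u \<theta>) w \<eta> - xs) < \<epsilon> / 2 \<Longrightarrow>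
     alg_step f \<theta> \<Omega> x0 xs Nb \<rho> \<beta> \<epsilon> (Plan T u \<mu> \<kappa> \<eta>) (Test T u \<mu> \<kappa> \<eta> N w)"
| accept:
    "(\<lambda>\<xi>. sol f (T + N) T (sol f T 0 x0 u \<theta>) w \<xi>) ` ball \<eta> (\<kappa> * \<mu>)
       \<subseteq> ball (sol f (T + N) T (sol f T 0 x0 u \<theta>) w \<eta>) (\<epsilon> / 2) \<Longrightarrow>
     alg_step f \<theta> \<Omega> x0 xs Nb \<rho> \<beta> \<epsilon> (Test T u \<mu> \<kappa> \<eta> N w) (Outer (T + N) w \<mu> \<kappa>)"
| reject:
    "\<not> (\<lambda>\<xi>. sol f (T + N) T (sol f T 0 x0 u \<theta>) w \<xi>) ` ball \<eta> (\<kappa> * \<mu>)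
       \<subseteq> ball (sol f (T + N) T (sol f T 0 x0 u \<theta>) w \<eta>) (\<epsilon> / 2) \<Longrightarrow>
     alg_step f \<theta> \<Omega> x0 xs Nb \<rho> \<beta> \<epsilon> (Test T u \<mu> \<kappa> \<eta> N w) (Estimate T u (\<beta> * \<mu>) \<kappa>)"

end

theory Submission
  imports Defs
begin

text \<open>
  With \<open>T\<close>, the past inputs and \<open>\<kappa>\<close> fixed, the solution is uniformly continuous on compact sets, so the
  test (c) succeeds once \<open>\<kappa> \<mu>\<close> is small, and the inner loop ends. If the outer loop ran forever, the
  accepted estimates \<open>\<theta>\<^sub>k\<close> would have an accumulation point \<open>l\<close> in \<open>\<Omega>\<close>. Output errors only grow with
  \<open>k\<close> and \<open>\<mu>\<^sub>k\<close> tends to 0, so \<open>l\<close> reproduces the whole actual trajectory, although it may differ from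
  \<open>\<theta>\<close>. The excitation phase makes the output error grow linearly around \<open>l\<close>, so
  \<open>\<bar>\<theta>\<^sub>k - l\<bar> \<le> C \<mu>\<^sub>k\<close> near \<open>l\<close>, and \<open>C \<mu>\<^sub>k < \<kappa>\<^sub>k \<mu>\<^sub>k\<close> eventually because \<open>\<kappa>\<^sub>k\<close> tends to infinity. The
  accepted test then places the state predicted with \<open>l\<close>, which is the actual one, within \<open>\<epsilon>\<close> of the
  target, so that the algorithm stops.
\<close>

section \<open>Solutions\<close>

lemma sol_cong:
  assumes "\<And>s. s < t \<Longrightarrow> u s = w s"
  shows "sol f t t0 x u \<xi> = sol f t t0 x w \<xi>"
  using assms by (induction t) auto

lemma sol_start: "t \<le> t0 \<Longrightarrow> sol f t t0 x u \<xi> = x"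
  by (cases t) auto

lemma sol_append: "sol f (T + N) T (sol f T 0 x u \<xi>) u \<xi> = sol f (T + N) 0 x u \<xi>"
  by (induction N) (auto simp: sol_start)

text \<open>Time invariance moves a planning phase from start time \<open>T\<close> to start time 0,
  where plans and uniform estimates are stated.\<close>

lemma sol_shift: "sol f (T + N) T x u \<xi> = sol f N 0 x (\<lambda>t. u (T + t)) \<xi>"
  by (induction N) (auto simp: sol_start)

lemma sol_differentiable:
  fixes f :: "'s::real_normed_vector \<Rightarrow> 'u::real_normed_vector \<Rightarrow> 'q::real_normed_vector \<Rightarrow> 's"
  assumes "\<And>z. (\<lambda>(x, v, \<xi>). f x v \<xi>) differentiable (at z)"
  shows "(\<lambda>\<xi>. sol f t 0 x u \<xi>) differentiable (at \<xi>)"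
proof (induction t)
  case 0
  then show ?case by simp
next
  case (Suc t)
  obtain D where "((\<lambda>\<xi>. sol f t 0 x u \<xi>) has_derivative D) (at \<xi>)"
    using Suc differentiable_def by blast
  then have "((\<lambda>\<xi>. (sol f t 0 x u \<xi>, u t, \<xi>)) has_derivative (\<lambda>h. (D h, 0, h))) (at \<xi>)"
    by (auto intro!: derivative_eq_intros)
  then have "(\<lambda>\<xi>. (sol f t 0 x u \<xi>, u t, \<xi>)) differentiable (at \<xi>)"
    using differentiable_def by blast
  then have "((\<lambda>(x, v, \<xi>). f x v \<xi>) \<circ> (\<lambda>\<xi>. (sol f t 0 x u \<xi>, u t, \<xi>))) differentiable (at \<xi>)"
    by (intro differentiable_chain_at assms)
  then show ?case by (simp add: o_def)
qed

text \<open>Each step maps a compact product of states, inputs and parameters to a compact image.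
  One \<open>K\<close> serves all input sequences in \<open>V\<close>, so \<open>f\<close> is
  uniformly continuous where it is evaluated.\<close>

lemma sol_compact:
  fixes f :: "'s::topological_space \<Rightarrow> 'u::topological_space \<Rightarrow> 'q::topological_space \<Rightarrow> 's"
  assumes f: "continuous_on UNIV (\<lambda>(x, v, \<xi>). f x v \<xi>)" and V: "compact V" and Z: "compact Z"
  shows "\<exists>K. compact K \<and> (\<forall>u. \<forall>\<xi>\<in>Z. (\<forall>t<N. u t \<in> V) \<longrightarrow> sol f N 0 x u \<xi> \<in> K)"
proof (induction N)
  case 0
  then show ?case by (intro exI[of _ "{x}"]) auto
next
  case (Suc N)
  then obtain K where K: "compact K"
    and solK: "\<And>u \<xi>. \<xi> \<in> Z \<Longrightarrow> \<forall>t<N. u t \<in> V \<Longrightarrow> sol f N 0 x u \<xi> \<in> K"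
    by blast
  let ?K = "(\<lambda>(x, v, \<xi>). f x v \<xi>) ` (K \<times> V \<times> Z)"
  have "compact ?K"
    by (intro compact_continuous_image continuous_on_subset[OF f] compact_Times K V Z) auto
  moreover have "\<forall>u. \<forall>\<xi>\<in>Z. (\<forall>t<Suc N. u t \<in> V) \<longrightarrow> sol f (Suc N) 0 x u \<xi> \<in> ?K"
  proof (intro allI ballI impI)
    fix u \<xi> assume "\<xi> \<in> Z" "\<forall>t<Suc N. u t \<in> V"
    then have "(sol f N 0 x u \<xi>, u N, \<xi>) \<in> K \<times> V \<times> Z"
      using solK by simp
    then show "sol f (Suc N) 0 x u \<xi> \<in> ?K"
      by (force intro: rev_image_eqI)
  qed
  ultimately show ?case by blast
qed

text \<open>The modulus must not depend on the input sequence, which the algorithm may choose anew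
  in every iteration. The induction generalizes over \<open>e\<close>: a modulus of \<open>f\<close>
  is split evenly between state error and parameter error.\<close>

lemma sol_modulus:
  fixes f :: "'s::metric_space \<Rightarrow> 'u::metric_space \<Rightarrow> 'q::metric_space \<Rightarrow> 's"
  assumes f: "continuous_on UNIV (\<lambda>(x, v, \<xi>). f x v \<xi>)" and V: "compact V" and Z: "compact Z"
    and e: "0 < e"
  shows "\<exists>d>0. \<forall>u. \<forall>\<xi>\<in>Z. \<forall>\<zeta>\<in>Z. (\<forall>t<N. u t \<in> V) \<longrightarrow> dist \<xi> \<zeta> < d \<longrightarrow>
           dist (sol f N 0 x u \<xi>) (sol f N 0 x u \<zeta>) < e"
  using e
proof (induction N arbitrary: e)
  case 0
  then show ?case by (intro exI[of _ 1]) auto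
next
  case (Suc N)
  obtain K where K: "compact K"
    and solK: "\<And>u \<xi>. \<xi> \<in> Z \<Longrightarrow> \<forall>t<N. u t \<in> V \<Longrightarrow> sol f N 0 x u \<xi> \<in> K"
    using sol_compact[OF f V Z] by metis
  have "uniformly_continuous_on (K \<times> V \<times> Z) (\<lambda>(x, v, \<xi>). f x v \<xi>)"
    by (intro compact_uniformly_continuous continuous_on_subset[OF f] compact_Times K V Z) auto
  then obtain d where d: "d > 0" and fd: "\<And>z z'. z \<in> K \<times> V \<times> Z \<Longrightarrow> z' \<in> K \<times> V \<times> Z \<Longrightarrow> dist z' z < d \<Longrightarrow>
      dist ((\<lambda>(x, v, \<xi>). f x v \<xi>) z') ((\<lambda>(x, v, \<xi>). f x v \<xi>) z) < e"
    unfolding uniformly_continuous_on_def using Suc.prems by metis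
  obtain d' where d': "d' > 0"
    and IH: "\<And>u \<xi> \<zeta>. \<xi> \<in> Z \<Longrightarrow> \<zeta> \<in> Z \<Longrightarrow> \<forall>t<N. u t \<in> V \<Longrightarrow> dist \<xi> \<zeta> < d' \<Longrightarrow>
      dist (sol f N 0 x u \<xi>) (sol f N 0 x u \<zeta>) < d / 2"
    using Suc.IH[of "d / 2"] d by auto
  have "dist (sol f (Suc N) 0 x u \<xi>) (sol f (Suc N) 0 x u \<zeta>) < e"
    if Z': "\<xi> \<in> Z" "\<zeta> \<in> Z" and u: "\<forall>t<Suc N. u t \<in> V" and close: "dist \<xi> \<zeta> < min d' (d / 2)" for u \<xi> \<zeta>
  proof -
    let ?z = "\<lambda>\<xi>. (sol f N 0 x u \<xi>, u N, \<xi>)"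
    have "dist (?z \<xi>) (?z \<zeta>) \<le> dist (sol f N 0 x u \<xi>) (sol f N 0 x u \<zeta>) + dist \<xi> \<zeta>"
      by (simp add: dist_Pair_Pair sqrt_sum_squares_le_sum)
    also have "\<dots> < d"
      using IH[OF Z', of u] u close by simp
    finally show ?thesis
      using fd[of "?z \<zeta>" "?z \<xi>"] solK Z' u by simp
  qed
  then show ?case using d d' by (intro exI[of _ "min d' (d / 2)"]) auto
qed

text \<open>Horizons vary between iterations but stay bounded, so the least of finitely many moduli
  suits all of them.\<close>

lemma sol_modulus_upto:
  fixes f :: "'s::metric_space \<Rightarrow> 'u::metric_space \<Rightarrow> 'q::metric_space \<Rightarrow> 's"
  assumes f: "continuous_on UNIV (\<lambda>(x, v, \<xi>). f x v \<xi>)" and V: "compact V" and Z: "compact Z"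
    and e: "0 < e"
  shows "\<exists>d>0. \<forall>N\<le>M. \<forall>u. \<forall>\<xi>\<in>Z. \<forall>\<zeta>\<in>Z. (\<forall>t<N. u t \<in> V) \<longrightarrow> dist \<xi> \<zeta> < d \<longrightarrow>
           dist (sol f N 0 x u \<xi>) (sol f N 0 x u \<zeta>) < e"
proof -
  obtain d where d: "\<And>N. d N > 0"
    and sol_d: "\<And>N u \<xi> \<zeta>. \<xi> \<in> Z \<Longrightarrow> \<zeta> \<in> Z \<Longrightarrow> \<forall>t<N. u t \<in> V \<Longrightarrow> dist \<xi> \<zeta> < d N \<Longrightarrow>
      dist (sol f N 0 x u \<xi>) (sol f N 0 x u \<zeta>) < e"
    using sol_modulus[OF f V Z e, of _ x] by metis
  have "0 < Min (d ` {..M})" and "\<forall>N\<le>M. Min (d ` {..M}) \<le> d N"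
    using d by auto
  then show ?thesis
    using sol_d by (intro exI[of _ "Min (d ` {..M})"]) fastforce
qed

section \<open>Local identifiability\<close>

lemma output_error_nonneg: "0 \<le> output_error f \<theta> x0 T u \<xi>"
  by (simp add: output_error_def)

text \<open>A longer window adds nonnegative squares, and states up to time \<open>S\<close> read
  only inputs before \<open>S\<close>. An estimate that fits later data thus fits earlier data at
  least as well.\<close>

lemma output_error_mono:
  assumes "S \<le> T" "\<And>t. t < S \<Longrightarrow> w t = u t"
  shows "output_error f \<theta> x0 S u \<xi> \<le> output_error f \<theta> x0 T w \<xi>"
proof -
  have "sol f t 0 x0 u \<zeta> = sol f t 0 x0 w \<zeta>" if "t \<le> S" for t \<zeta>
    using assms(2) that by (intro sol_cong) simp
  then have "output_error f \<theta> x0 S u \<xi> = output_error f \<theta> x0 S w \<xi>"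
    unfolding output_error_def by (intro L2_set_cong) auto
  also have "\<dots> \<le> output_error f \<theta> x0 T w \<xi>"
    unfolding output_error_def L2_set_def using assms(1)
    by (intro real_sqrt_le_mono sum_mono2) auto
  finally show ?thesis .
qed

lemma output_error_ge:
  assumes "t \<le> T"
  shows "norm (sol f t 0 x0 u \<xi> - sol f t 0 x0 u \<theta>) \<le> output_error f \<theta> x0 T u \<xi>"
\<comment> \<open>Time 0 is missing from the sum, but there both solutions equal
  \<open>x0\<close>.\<close>
proof (cases "t = 0")
  case True
  then show ?thesis by (simp add: output_error_nonneg)
next
  case False
  then show ?thesis unfolding output_error_def using assms
    by (intro member_le_L2_set[where f = "\<lambda>t. norm (sol f t 0 x0 u \<xi> - sol f t 0 x0 u \<theta>)"]) auto
qed

text \<open>A common kernel vector is orthogonal to every row, hence to the row space, which is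
  everything and so contains the vector itself.\<close>

lemma trivial_kernel_of_full_row_rank:
  fixes A :: "'i \<Rightarrow> real^'p^'n"
  assumes dim: "dim (\<Union>t\<in>I. rows (A t)) = CARD('p)" and zero: "\<And>t. t \<in> I \<Longrightarrow> A t *v v = 0"
  shows "v = 0"
proof -
  let ?R = "\<Union>t\<in>I. rows (A t)"
  have "orthogonal v y" if "y \<in> ?R" for y
    using that zero
    by (fastforce simp: rows_def row_def orthogonal_def vec_eq_iff matrix_vector_mult_def inner_vec_def
        mult.commute)
  then have "orthogonal v y" if "y \<in> span ?R" for y
    using that orthogonal_to_span by blast
  moreover have "span ?R = UNIV"
    using dim by (metis DIM_cart DIM_real dim_eq_full mult.right_neutral)
  ultimately show ?thesis
    using orthogonal_self by blast
qed

text \<open>The stacked Jacobian at \<xi> is injective by the rank condition, so its linear term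
  dominates the first-order remainder near \<xi>. By \<open>match\<close>, deviations from the
  states under \<theta> are deviations from those under \<xi>.\<close>

lemma output_error_expansive:
  fixes f :: "real^'n \<Rightarrow> real^'m \<Rightarrow> real^'p \<Rightarrow> real^'n"
  assumes f: "\<And>z. (\<lambda>(x, v, \<xi>). f x v \<xi>) differentiable (at z)"
    and rank: "rank_param_jacobian f N x0 u \<xi> = CARD('p)"
    and match: "\<And>t. t \<le> N \<Longrightarrow> sol f t 0 x0 u \<xi> = sol f t 0 x0 u \<theta>"
  shows "\<exists>c>0. \<forall>\<^sub>F \<zeta> in nhds \<xi>. c * norm (\<zeta> - \<xi>) \<le> output_error f \<theta> x0 N u \<zeta>"
proof -
  define F where "F t = sol f t 0 x0 u" for t
  define J where "J t = jacobian (F t) (at \<xi>)" for t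
  have J: "(F t has_derivative (*v) (J t)) (at \<xi>)" for t
    using sol_differentiable[OF f] unfolding F_def J_def
    by (simp add: jacobian_works)
  \<comment> \<open>The minimum of \<open>q\<close> on the compact unit sphere is positive by
    injectivity and extends to all vectors by homogeneity.\<close>
  define q where "q v = (\<Sum>t\<le>N. norm (J t *v v))" for v
  have "continuous_on (sphere 0 1) q"
    unfolding q_def by (intro continuous_intros)
  then obtain v0 where v0: "v0 \<in> sphere 0 1" and min: "\<And>v. v \<in> sphere 0 1 \<Longrightarrow> q v0 \<le> q v"
    using continuous_attains_inf[of "sphere (0::real^'p) 1" q] by (auto simp: sphere_eq_empty)
  have "q v0 \<noteq> 0"
  proof
    assume "q v0 = 0"
    then have "J t *v v0 = 0" if "t \<le> N" for t
      using that by (simp add: q_def sum_nonneg_eq_0_iff)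
    then have "v0 = 0"
      using rank trivial_kernel_of_full_row_rank[of J "{..N}" v0]
      by (auto simp: rank_param_jacobian_def param_jacobian_rows_def J_def F_def)
    then show False using v0 by simp
  qed
  then have m: "0 < q v0"
    unfolding q_def by (simp add: sum_nonneg order_less_le)
  have q_ge: "q v0 * norm v \<le> q v" for v
  proof (cases "v = 0")
    case True
    then show ?thesis by (simp add: q_def)
  next
    case False
    then have "q v0 \<le> q (v /\<^sub>R norm v)"
      by (intro min) simp
    also have "\<dots> = q v / norm v"
      by (simp add: q_def sum_divide_distrib matrix_vector_mult_scaleR divide_inverse mult.commute
          sum_distrib_left)
    finally show ?thesis using False by (simp add: field_simps)
  qed
  \<comment> \<open>The \<open>N + 1\<close> remainders, each at most \<open>e\<close> times the
    distance, use up half of \<open>q v0\<close>. Dividing the other half by \<open>N + 1\<close>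
    gives \<open>e\<close> again, now as the growth constant.\<close>
  define e where "e = q v0 / (2 * (real N + 1))"
  have e: "0 < e" using m by (simp add: e_def)
  have "\<forall>\<^sub>F \<zeta> in nhds \<xi>. norm (F t \<zeta> - F t \<xi> - J t *v (\<zeta> - \<xi>)) \<le> e * norm (\<zeta> - \<xi>)" for t
    using J[of t] e unfolding has_derivative_at_alt eventually_nhds_metric
    by (metis dist_norm)
  then have "\<forall>\<^sub>F \<zeta> in nhds \<xi>. \<forall>t\<in>{..N}. norm (F t \<zeta> - F t \<xi> - J t *v (\<zeta> - \<xi>)) \<le> e * norm (\<zeta> - \<xi>)"
    by (intro eventually_ball_finite) auto
  then have "\<forall>\<^sub>F \<zeta> in nhds \<xi>. e * norm (\<zeta> - \<xi>) \<le> output_error f \<theta> x0 N u \<zeta>"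
  proof eventually_elim
    case (elim \<zeta>)
    have "q v0 * norm (\<zeta> - \<xi>) \<le> q (\<zeta> - \<xi>)" by (rule q_ge)
    also have "\<dots> \<le> (\<Sum>t\<le>N. output_error f \<theta> x0 N u \<zeta> + e * norm (\<zeta> - \<xi>))"
      unfolding q_def
    proof (rule sum_mono)
      fix t assume "t \<in> {..N}"
      then have t: "t \<le> N" by simp
      have "norm (F t \<zeta> - F t \<xi>) \<le> output_error f \<theta> x0 N u \<zeta>"
        using output_error_ge[OF t] match[OF t] by (simp add: F_def)
      moreover have "norm (J t *v (\<zeta> - \<xi>)) \<le>
          norm (F t \<zeta> - F t \<xi>) + norm (F t \<zeta> - F t \<xi> - J t *v (\<zeta> - \<xi>))"
        by (metis norm_minus_commute norm_triangle_sub)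
      ultimately show "norm (J t *v (\<zeta> - \<xi>)) \<le> output_error f \<theta> x0 N u \<zeta> + e * norm (\<zeta> - \<xi>)"
        using bspec[OF elim, of t] t by simp
    qed
    also have "\<dots> = (real N + 1) * output_error f \<theta> x0 N u \<zeta> + (real N + 1) * e * norm (\<zeta> - \<xi>)"
      by (simp add: algebra_simps)
    also have "(real N + 1) * e = q v0 / 2" by (simp add: e_def field_simps)
    finally have "q v0 / 2 * norm (\<zeta> - \<xi>) \<le> (real N + 1) * output_error f \<theta> x0 N u \<zeta>"
      by simp
    then show ?case by (simp add: e_def field_simps)
  qed
  then show ?thesis using e by blast
qed

section \<open>Runs of the algorithm\<close>

fun clock :: "('u, 'q) config \<Rightarrow> nat" where
  "clock (Outer T u \<mu> \<kappa>) = T"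
| "clock (Estimate T u \<mu> \<kappa>) = T"
| "clock (Plan T u \<mu> \<kappa> \<eta>) = T"
| "clock (Test T u \<mu> \<kappa> \<eta> N w) = T"
| "clock (Halted T u) = T"

text \<open>Planned inputs \<open>w\<close> count as history only after acceptance, since a rejected
  plan is discarded.\<close>

fun history :: "('u, 'q) config \<Rightarrow> nat \<Rightarrow> 'u" where
  "history (Outer T u \<mu> \<kappa>) = u"
| "history (Estimate T u \<mu> \<kappa>) = u"
| "history (Plan T u \<mu> \<kappa> \<eta>) = u"
| "history (Test T u \<mu> \<kappa> \<eta> N w) = u"
| "history (Halted T u) = u"

text \<open>The value 1 after halting, here and for the gain, is a placeholder that keeps both
  positive.\<close>

fun tolerance :: "('u, 'q) config \<Rightarrow> real" where
  "tolerance (Outer T u \<mu> \<kappa>) = \<mu>"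
| "tolerance (Estimate T u \<mu> \<kappa>) = \<mu>"
| "tolerance (Plan T u \<mu> \<kappa> \<eta>) = \<mu>"
| "tolerance (Test T u \<mu> \<kappa> \<eta> N w) = \<mu>"
| "tolerance (Halted T u) = 1"

fun gain :: "('u, 'q) config \<Rightarrow> real" where
  "gain (Outer T u \<mu> \<kappa>) = \<kappa>"
| "gain (Estimate T u \<mu> \<kappa>) = \<kappa>"
| "gain (Plan T u \<mu> \<kappa> \<eta>) = \<kappa>"
| "gain (Test T u \<mu> \<kappa> \<eta> N w) = \<kappa>"
| "gain (Halted T u) = 1"

text \<open>Applied to the tolerances and also to the inverse gains, so that the gains tend to
  infinity.\<close>

lemma geometric_decay_tendsto_0:
  fixes b :: "nat \<Rightarrow> real"
  assumes "0 < \<beta>" "\<beta> < 1" "\<And>j. 0 \<le> b j" "\<And>j. b (Suc j) \<le> \<beta> * b j"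
  shows "b \<longlonglongrightarrow> 0"
proof (rule tendsto_sandwich[OF _ _ tendsto_const])
  have "b j \<le> \<beta> ^ j * b 0" for j
  proof (induction j)
    case (Suc j)
    have "b (Suc j) \<le> \<beta> * b j" by (rule assms)
    also have "\<dots> \<le> \<beta> * (\<beta> ^ j * b 0)" using Suc assms(1) by simp
    finally show ?case by simp
  qed simp
  then show "\<forall>\<^sub>F j in sequentially. b j \<le> \<beta> ^ j * b 0" by simp
  have "(\<lambda>j. \<beta> ^ j) \<longlonglongrightarrow> 0"
    using assms by (intro LIMSEQ_power_zero) simp
  then show "(\<lambda>j. \<beta> ^ j * b 0) \<longlonglongrightarrow> 0"
    by (rule tendsto_mult_left_zero)
qed (use assms in auto)

section \<open>Invariant and absence of deadlock\<close>

locale regulation =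
  fixes f :: "real^'n \<Rightarrow> real^'m \<Rightarrow> real^'p \<Rightarrow> real^'n"
    and \<Omega> :: "(real^'p) set" and \<theta> :: "real^'p"
    and xs x0 :: "real^'n"
    and Nb :: "real^'n \<Rightarrow> nat" and \<rho> :: "real^'n \<Rightarrow> real"
    and \<beta> \<epsilon> :: real
  assumes f_differentiable: "\<And>z. (\<lambda>(x, v, \<xi>). f x v \<xi>) differentiable (at z)"
    and Omega_compact: "compact \<Omega>" and theta_in: "\<theta> \<in> \<Omega>"
    and plan_exists: "\<And>x \<xi>. \<xi> \<in> \<Omega> \<Longrightarrow>
      \<exists>N\<le>Nb x. \<exists>u. (\<forall>t<N. u t \<in> cball 0 (\<rho> x)) \<and> sol f N 0 x u \<xi> = xs"
    and beta: "0 < \<beta>" "\<beta> < 1" and eps: "0 < \<epsilon>"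
begin

abbreviation "step \<equiv> alg_step f \<theta> \<Omega> x0 xs Nb \<rho> \<beta> \<epsilon>"

lemma f_continuous: "continuous_on UNIV (\<lambda>(x, v, \<xi>). f x v \<xi>)"
  using f_differentiable differentiable_imp_continuous_on differentiable_on_def
    differentiable_at_withinI by blast

lemma sol_isCont: "isCont (\<lambda>\<xi>. sol f t 0 x u \<xi>) \<xi>"
  using sol_differentiable[OF f_differentiable] by (rule differentiable_imp_continuous_within)

text \<open>The invariant retains the guards of (a) and (b), which are needed again when a test is
  analysed; on a halted configuration it is the claimed final accuracy.\<close>

fun consistent :: "(real^'m, real^'p) config \<Rightarrow> bool" where
  "consistent (Outer T u \<mu> \<kappa>) \<longleftrightarrow> 0 < \<mu> \<and> 0 < \<kappa>"
| "consistent (Estimate T u \<mu> \<kappa>) \<longleftrightarrow> 0 < \<mu> \<and> 0 < \<kappa>"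
| "consistent (Plan T u \<mu> \<kappa> \<eta>) \<longleftrightarrow> 0 < \<mu> \<and> 0 < \<kappa> \<and> \<eta> \<in> \<Omega> \<and> output_error f \<theta> x0 T u \<eta> < \<mu>"
| "consistent (Test T u \<mu> \<kappa> \<eta> N w) \<longleftrightarrow> 0 < \<mu> \<and> 0 < \<kappa> \<and> \<eta> \<in> \<Omega> \<and> output_error f \<theta> x0 T u \<eta> < \<mu> \<and>
     N \<le> Nb (sol f T 0 x0 u \<theta>) \<and> (\<forall>t<T. w t = u t) \<and>
     (\<forall>t\<in>{T..<T + N}. w t \<in> cball 0 (\<rho> (sol f T 0 x0 u \<theta>))) \<and>
     norm (sol f (T + N) T (sol f T 0 x0 u \<theta>) w \<eta> - xs) < \<epsilon> / 2"
| "consistent (Halted T u) \<longleftrightarrow> norm (sol f T 0 x0 u \<theta> - xs) < \<epsilon>"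

lemma consistent_step: "step c c' \<Longrightarrow> consistent c \<Longrightarrow> consistent c'"
  by (cases rule: alg_step.cases) (use beta in auto)

lemma consistent_reachable: "step\<^sup>*\<^sup>* c c' \<Longrightarrow> consistent c \<Longrightarrow> consistent c'"
  by (induction rule: rtranclp_induct) (auto intro: consistent_step)

text \<open>Halting is excluded because of the placeholder values. Inputs are compared only before
  the current clock, as acceptance may overwrite later entries of the total function.\<close>

lemma step_monotone:
  assumes "step c c'" "consistent c" "\<nexists>T u. c' = Halted T u"
  shows "tolerance c' \<le> tolerance c" "gain c \<le> gain c'" "clock c \<le> clock c'"
    "\<forall>t<clock c. history c' t = history c t"
  using assms beta by (cases rule: alg_step.cases; auto simp: field_simps)+

text \<open>The true parameter has output error 0 and is always admissible in (a); an exact plan for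
  the estimate, shifted to time \<open>T\<close>, is admissible in (b); the guards at the outer loop
  and at the test are complementary.\<close>

lemma progress:
  assumes "consistent c" "\<nexists>T u. c = Halted T u"
  shows "\<exists>c'. step c c'"
proof (cases c)
  case (Outer T u \<mu> \<kappa>)
  then show ?thesis by (blast intro: alg_step.break alg_step.enter)
next
  case (Estimate T u \<mu> \<kappa>)
  moreover have "output_error f \<theta> x0 T u \<theta> = 0"
    by (simp add: output_error_def L2_set_def)
  ultimately show ?thesis using assms theta_in by (metis alg_step.estimate consistent.simps(2))
next
  case (Plan T u \<mu> \<kappa> \<eta>)
  let ?x = "sol f T 0 x0 u \<theta>"
  obtain N v where N: "N \<le> Nb ?x" and v: "\<forall>t<N. v t \<in> cball 0 (\<rho> ?x)" "sol f N 0 ?x v \<eta> = xs"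
    using plan_exists Plan assms by (metis consistent.simps(3))
  define w where "w t = (if t < T then u t else v (t - T))" for t
  have "step (Plan T u \<mu> \<kappa> \<eta>) (Test T u \<mu> \<kappa> \<eta> N w)"
    using N v eps by (intro alg_step.plan) (auto simp: w_def sol_shift)
  then show ?thesis using Plan by blast
next
  case (Test T u \<mu> \<kappa> \<eta> N w)
  then show ?thesis by (blast intro: alg_step.accept alg_step.reject)
next
  case (Halted T u)
  then show ?thesis using assms by blast
qed

end

section \<open>Infinite runs and their impossibility\<close>

locale infinite_run = regulation f \<Omega> \<theta> xs x0 Nb \<rho> \<beta> \<epsilon>
  for f :: "real^'n \<Rightarrow> real^'m \<Rightarrow> real^'p \<Rightarrow> real^'n"
    and \<Omega> \<theta> xs x0 Nb \<rho> \<beta> \<epsilon> +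
  fixes c :: "nat \<Rightarrow> (real^'m, real^'p) config"
  assumes consistent_0: "consistent (c 0)" and run: "\<And>i. step (c i) (c (Suc i))"
begin

lemma consistent: "consistent (c i)"
  by (induction i) (auto intro: consistent_0 consistent_step run)

lemma not_halted: "c i \<noteq> Halted T u"
  using run[of i] by (cases rule: alg_step.cases) auto

lemma tolerance_mono: "i \<le> j \<Longrightarrow> tolerance (c j) \<le> tolerance (c i)"
  by (rule lift_Suc_antimono_le[of "\<lambda>i. tolerance (c i)"])
    (use step_monotone[OF run consistent] not_halted in auto)

lemma gain_mono: "i \<le> j \<Longrightarrow> gain (c i) \<le> gain (c j)"
  by (rule lift_Suc_mono_le[of "\<lambda>i. gain (c i)"])
    (use step_monotone[OF run consistent] not_halted in auto)

lemma clock_mono: "i \<le> j \<Longrightarrow> clock (c i) \<le> clock (c j)"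
  by (rule lift_Suc_mono_le[of "\<lambda>i. clock (c i)"])
    (use step_monotone[OF run consistent] not_halted in auto)

lemma history_agree: "i \<le> j \<Longrightarrow> t < clock (c i) \<Longrightarrow> history (c j) t = history (c i) t"
proof (induction j rule: dec_induct)
  case (step j)
  then have "t < clock (c j)" using clock_mono order_less_le_trans by blast
  then show ?case using step step_monotone(4)[OF run consistent] not_halted by metis
qed simp

lemma tolerance_pos: "0 < tolerance (c i)"
  using consistent[of i] by (cases "c i") auto

lemma gain_pos: "0 < gain (c i)"
  using consistent[of i] by (cases "c i") auto

text \<open>The phases follow in the order outer, estimate, plan, test, so at most three steps are
  needed.\<close>

lemma test_occurs: "\<exists>j\<ge>i. \<exists>T u \<mu> \<kappa> \<eta> N w. c j = Test T u \<mu> \<kappa> \<eta> N w"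
proof -
  define is_test where "is_test j \<longleftrightarrow> (\<exists>T u \<mu> \<kappa> \<eta> N w. c j = Test T u \<mu> \<kappa> \<eta> N w)" for j
  have from_plan: "\<exists>j\<ge>i. is_test j" if at: "c i = Plan T u \<mu> \<kappa> \<eta>" for i T u \<mu> \<kappa> \<eta>
  proof -
    have "is_test (Suc i)"
      using run[of i] at unfolding is_test_def by (cases rule: alg_step.cases) auto
    then show ?thesis by (meson le_Suc_eq order_refl)
  qed
  have from_estimate: "\<exists>j\<ge>i. is_test j" if at: "c i = Estimate T u \<mu> \<kappa>" for i T u \<mu> \<kappa>
  proof -
    obtain \<eta> where "c (Suc i) = Plan T u \<mu> \<kappa> \<eta>"
      using run[of i] at by (cases rule: alg_step.cases) auto
    then show ?thesis using from_plan Suc_leD by blast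
  qed
  have "\<exists>j\<ge>i. is_test j"
  proof (cases "c i")
    case at: (Outer T u \<mu> \<kappa>)
    obtain \<mu>' \<kappa>' where "c (Suc i) = Estimate T u \<mu>' \<kappa>'"
      using run[of i] at not_halted[of "Suc i"] by (cases rule: alg_step.cases) auto
    then show ?thesis using from_estimate Suc_leD by blast
  next
    case Test
    then show ?thesis unfolding is_test_def by blast
  qed (use from_estimate from_plan not_halted in blast)+
  then show ?thesis unfolding is_test_def .
qed

text \<open>Otherwise every later test is rejected and shrinks the tolerance by \<beta> at fixed
  state and gain. The radius of the tested ball then falls below a modulus valid for all admissible
  plans from that state, which forces acceptance.\<close>

lemma outer_occurs: "\<exists>j>i. \<exists>T u \<mu> \<kappa>. c j = Outer T u \<mu> \<kappa>"
proof (rule ccontr)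
  assume neg: "\<not> ?thesis"
  \<comment> \<open>\<open>c i\<close> may itself be an outer configuration, whose next step changes
    the gain; the data are therefore frozen only from \<open>Suc i\<close> on.\<close>
  have stay: "clock (c (Suc j)) = clock (c j) \<and> history (c (Suc j)) = history (c j) \<and> gain (c (Suc j)) = gain (c j)"
    if "j > i" for j
    using run[of j] neg that not_halted[of "Suc j"] less_SucI[OF that]
    by (cases rule: alg_step.cases) auto
  define T u \<kappa> where "T = clock (c (Suc i))" and "u = history (c (Suc i))" and "\<kappa> = gain (c (Suc i))"
  have const: "clock (c j) = T \<and> history (c j) = u \<and> gain (c j) = \<kappa>" if "j > i" for j
    using Suc_leI[OF that] by (induction j rule: dec_induct) (simp_all add: T_def u_def \<kappa>_def stay)
  have kappa: "0 < \<kappa>" unfolding \<kappa>_def by (rule gain_pos)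
  let ?S = "{j. j > i \<and> (\<exists>T u \<mu> \<kappa> \<eta> N w. c j = Test T u \<mu> \<kappa> \<eta> N w)}"
  have inf: "infinite ?S"
    unfolding infinite_nat_iff_unbounded_le
  proof
    fix k
    obtain j where "j \<ge> max k (Suc i)" "\<exists>T u \<mu> \<kappa> \<eta> N w. c j = Test T u \<mu> \<kappa> \<eta> N w"
      using test_occurs by blast
    then show "\<exists>j\<ge>k. j \<in> ?S" by auto
  qed
  obtain r :: "nat \<Rightarrow> nat" where r: "strict_mono r" "\<And>j. r j \<in> ?S"
    using infinite_enumerate[OF inf] by blast
  have rejected: "\<exists>\<mu> \<eta> N w. c (r j) = Test T u \<mu> \<kappa> \<eta> N w \<and> c (Suc (r j)) = Estimate T u (\<beta> * \<mu>) \<kappa> \<and>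
     \<not> (\<lambda>\<xi>. sol f (T + N) T (sol f T 0 x0 u \<theta>) w \<xi>) ` ball \<eta> (\<kappa> * \<mu>)
       \<subseteq> ball (sol f (T + N) T (sol f T 0 x0 u \<theta>) w \<eta>) (\<epsilon> / 2)" for j
  proof -
    obtain T' u' \<mu> \<kappa>' \<eta> N w where eq: "c (r j) = Test T' u' \<mu> \<kappa>' \<eta> N w" and j: "r j > i"
      using r(2)[of j] by blast
    have same: "T' = T" "u' = u" "\<kappa>' = \<kappa>"
      using const[OF j] eq by auto
    show ?thesis
      using run[of "r j"] eq same neg less_SucI[OF j] by (cases rule: alg_step.cases) auto
  qed
  have "(\<lambda>j. tolerance (c (r j))) \<longlonglongrightarrow> 0"
  proof (rule geometric_decay_tendsto_0[OF beta])
    show "0 \<le> tolerance (c (r j))" for j using tolerance_pos less_imp_le by blast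
    have "Suc (r j) \<le> r (Suc j)" for j
      using r(1) by (simp add: Suc_leI strict_monoD)
    then show "tolerance (c (r (Suc j))) \<le> \<beta> * tolerance (c (r j))" for j
      using tolerance_mono[of "Suc (r j)" "r (Suc j)"] rejected[of j] by auto
  qed
  define x where "x = sol f T 0 x0 u \<theta>"
  \<comment> \<open>The tested ball may leave \<Omega>, so \<Omega> is thickened by 1; balls around
    estimates with radius below 1 stay inside this compact set.\<close>
  let ?Z = "{y + z | y z. y \<in> \<Omega> \<and> z \<in> cball 0 1}"
  have "compact ?Z" by (intro compact_sums Omega_compact compact_cball)
  then have "\<exists>d>0. \<forall>N\<le>Nb x. \<forall>v. \<forall>\<xi>\<in>?Z. \<forall>\<zeta>\<in>?Z. (\<forall>t<N. v t \<in> cball 0 (\<rho> x)) \<longrightarrow> dist \<xi> \<zeta> < d \<longrightarrow>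
      dist (sol f N 0 x v \<xi>) (sol f N 0 x v \<zeta>) < \<epsilon> / 2"
    using eps by (intro sol_modulus_upto f_continuous compact_cball) auto
  then obtain d where d: "0 < d" and sol_d: "\<forall>N\<le>Nb x. \<forall>v. \<forall>\<xi>\<in>?Z. \<forall>\<zeta>\<in>?Z.
      (\<forall>t<N. v t \<in> cball 0 (\<rho> x)) \<longrightarrow> dist \<xi> \<zeta> < d \<longrightarrow>
      dist (sol f N 0 x v \<xi>) (sol f N 0 x v \<zeta>) < \<epsilon> / 2"
    by (elim exE conjE)
  have "0 < min d 1 / \<kappa>" using d kappa by simp
  then obtain j where "tolerance (c (r j)) < min d 1 / \<kappa>"
    using \<open>(\<lambda>j. tolerance (c (r j))) \<longlonglongrightarrow> 0\<close> eventually_happens[OF order_tendstoD(2)] by fastforce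
  moreover obtain \<mu> \<eta> N w where eq: "c (r j) = Test T u \<mu> \<kappa> \<eta> N w" and
    fail: "\<not> (\<lambda>\<xi>. sol f (T + N) T x w \<xi>) ` ball \<eta> (\<kappa> * \<mu>) \<subseteq> ball (sol f (T + N) T x w \<eta>) (\<epsilon> / 2)"
    using rejected[of j] unfolding x_def by blast
  ultimately have small: "\<kappa> * \<mu> < min d 1"
    using kappa by (simp add: field_simps)
  have Test: "\<eta> \<in> \<Omega>" "N \<le> Nb x" "\<forall>t<N. w (T + t) \<in> cball 0 (\<rho> x)"
    using consistent[of "r j"] unfolding eq x_def by auto
  have "(\<lambda>\<xi>. sol f (T + N) T x w \<xi>) ` ball \<eta> (\<kappa> * \<mu>) \<subseteq> ball (sol f (T + N) T x w \<eta>) (\<epsilon> / 2)"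
  proof (rule image_subsetI)
    fix \<xi> assume "\<xi> \<in> ball \<eta> (\<kappa> * \<mu>)"
    then have dist: "dist \<eta> \<xi> < d" "dist \<eta> \<xi> < 1" using small by auto
    have "\<eta> \<in> ?Z"
      using Test(1) by (intro CollectI exI[of _ \<eta>] exI[of _ 0]) simp
    moreover have "\<xi> \<in> ?Z"
      using Test(1) dist(2) by (intro CollectI exI[of _ \<eta>] exI[of _ "\<xi> - \<eta>"]) (simp add: dist_norm norm_minus_commute)
    ultimately show "sol f (T + N) T x w \<xi> \<in> ball (sol f (T + N) T x w \<eta>) (\<epsilon> / 2)"
      unfolding sol_shift mem_ball using Test dist by (intro sol_d[rule_format]) auto
  qed
  then show False using fail by blast
qed

text \<open>The history of \<open>c 0\<close> takes the role of the excitation phase. The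
  contradiction is an accepted test after which the actual state must be within \<epsilon> of the
  target.\<close>

lemma no_infinite_run:
  assumes rank: "\<And>\<xi>. \<xi> \<in> \<Omega> \<Longrightarrow> rank_param_jacobian f (clock (c 0)) x0 (history (c 0)) \<xi> = CARD('p)"
  shows False
proof -
  \<comment> \<open>Only acceptance leads to an outer configuration, so the predecessors collected
    here are the accepted tests.\<close>
  let ?S = "{i. \<exists>T u \<mu> \<kappa>. c (Suc i) = Outer T u \<mu> \<kappa>}"
  have inf: "infinite ?S"
    unfolding infinite_nat_iff_unbounded_le
  proof
    fix k
    obtain j where "j > k" "\<exists>T u \<mu> \<kappa>. c j = Outer T u \<mu> \<kappa>"
      using outer_occurs by blast
    then show "\<exists>j\<ge>k. j \<in> ?S" by (cases j) (auto simp: less_Suc_eq_le)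
  qed
  obtain s :: "nat \<Rightarrow> nat" where s: "strict_mono s" "\<And>j. s j \<in> ?S"
    using infinite_enumerate[OF inf] by blast
  have "\<forall>j. \<exists>T u \<mu> \<kappa> \<eta> N w. c (s j) = Test T u \<mu> \<kappa> \<eta> N w \<and> c (Suc (s j)) = Outer (T + N) w \<mu> \<kappa> \<and>
      (\<lambda>\<xi>. sol f (T + N) T (sol f T 0 x0 u \<theta>) w \<xi>) ` ball \<eta> (\<kappa> * \<mu>)
       \<subseteq> ball (sol f (T + N) T (sol f T 0 x0 u \<theta>) w \<eta>) (\<epsilon> / 2)"
  proof
    fix j
    obtain T' u' \<mu>' \<kappa>' where at: "c (Suc (s j)) = Outer T' u' \<mu>' \<kappa>'"
      using s(2)[of j] by blast
    show "\<exists>T u \<mu> \<kappa> \<eta> N w. c (s j) = Test T u \<mu> \<kappa> \<eta> N w \<and> c (Suc (s j)) = Outer (T + N) w \<mu> \<kappa> \<and>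
      (\<lambda>\<xi>. sol f (T + N) T (sol f T 0 x0 u \<theta>) w \<xi>) ` ball \<eta> (\<kappa> * \<mu>)
       \<subseteq> ball (sol f (T + N) T (sol f T 0 x0 u \<theta>) w \<eta>) (\<epsilon> / 2)"
      using run[of "s j"] at by (cases rule: alg_step.cases) auto
  qed
  then obtain T u \<mu> \<kappa> \<eta> N w where test: "\<And>j. c (s j) = Test (T j) (u j) (\<mu> j) (\<kappa> j) (\<eta> j) (N j) (w j)"
    and outer: "\<And>j. c (Suc (s j)) = Outer (T j + N j) (w j) (\<mu> j) (\<kappa> j)"
    and accepted: "\<And>j. (\<lambda>\<xi>. sol f (T j + N j) (T j) (sol f (T j) 0 x0 (u j) \<theta>) (w j) \<xi>) ` ball (\<eta> j) (\<kappa> j * \<mu> j)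
       \<subseteq> ball (sol f (T j + N j) (T j) (sol f (T j) 0 x0 (u j) \<theta>) (w j) (\<eta> j)) (\<epsilon> / 2)"
    by metis
  \<comment> \<open>An infinite run never takes the break, so after each acceptance the state is
    still at distance at least \<epsilon>; \<open>far\<close> is contradicted at the end.\<close>
  have estimate: "c (Suc (Suc (s j))) = Estimate (T j + N j) (w j) (\<beta> * \<mu> j) (\<kappa> j / \<beta>)"
    and far: "\<not> norm (sol f (T j + N j) 0 x0 (w j) \<theta> - xs) < \<epsilon>" for j
    using run[of "Suc (s j)"] outer[of j] not_halted[of "Suc (Suc (s j))"]
    by (cases rule: alg_step.cases; auto)+
  \<comment> \<open>Two indices are skipped in order to pass the outer step, which multiplies the
    tolerance and divides the gain by \<beta>; monotonicity then yields both decay rates.\<close>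
  have next_ge: "Suc (Suc (s j)) \<le> s (Suc j)" for j
  proof -
    have "Suc (s j) \<le> s (Suc j)" using s(1) by (simp add: Suc_leI strict_monoD)
    moreover have "Suc (s j) \<noteq> s (Suc j)" using outer[of j] test[of "Suc j"] by auto
    ultimately show ?thesis by simp
  qed
  have pos: "0 < \<mu> j" "0 < \<kappa> j" for j
    using tolerance_pos[of "s j"] gain_pos[of "s j"] by (simp_all add: test)
  have mu: "\<mu> \<longlonglongrightarrow> 0"
  proof (rule geometric_decay_tendsto_0[OF beta])
    show "\<mu> (Suc j) \<le> \<beta> * \<mu> j" for j
      using tolerance_mono[OF next_ge[of j]] by (simp add: test estimate)
  qed (use pos less_imp_le in blast)
  have inverse_kappa: "(\<lambda>j. inverse (\<kappa> j)) \<longlonglongrightarrow> 0"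
  proof (rule geometric_decay_tendsto_0[OF beta])
    show "inverse (\<kappa> (Suc j)) \<le> \<beta> * inverse (\<kappa> j)" for j
      using gain_mono[OF next_ge[of j]] pos[of j] pos[of "Suc j"] beta
      by (simp add: test estimate field_simps)
    show "0 \<le> inverse (\<kappa> j)" for j
      using pos[of j] by simp
  qed
  have Test: "\<eta> j \<in> \<Omega>" "output_error f \<theta> x0 (T j) (u j) (\<eta> j) < \<mu> j" "\<forall>t<T j. w j t = u j t"
    "norm (sol f (T j + N j) (T j) (sol f (T j) 0 x0 (u j) \<theta>) (w j) (\<eta> j) - xs) < \<epsilon> / 2" for j
    using consistent[of "s j"] unfolding test by auto
  obtain l q where l: "l \<in> \<Omega>" and q: "strict_mono q" and lim: "(\<eta> \<circ> q) \<longlonglongrightarrow> l"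
    using Omega_compact Test(1) unfolding compact_def by metis
  have mu_q: "(\<lambda>j. \<mu> (q j)) \<longlonglongrightarrow> 0" and kappa_q: "(\<lambda>j. inverse (\<kappa> (q j))) \<longlonglongrightarrow> 0"
    using LIMSEQ_subseq_LIMSEQ[OF mu q] LIMSEQ_subseq_LIMSEQ[OF inverse_kappa q] by (simp_all add: o_def)
  have error_small: "output_error f \<theta> x0 (clock (c i)) (history (c i)) (\<eta> j) < \<mu> j" if "i \<le> s j" for i j
  proof -
    have "output_error f \<theta> x0 (clock (c i)) (history (c i)) (\<eta> j) \<le> output_error f \<theta> x0 (T j) (u j) (\<eta> j)"
      using clock_mono[OF that] history_agree[OF that] by (intro output_error_mono) (simp_all add: test)
    also have "\<dots> < \<mu> j" by (rule Test)
    finally show ?thesis .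
  qed
  have le_sq: "i \<le> s (q j)" if "i \<le> j" for i j
    using seq_suble[OF s(1), of "q j"] seq_suble[OF q, of j] that by linarith
  \<comment> \<open>The data of a fixed \<open>c i\<close> are fitted within
    \<open>\<mu> (q j)\<close> by all late estimates; continuity in the parameter passes this to the
    limit \<open>l\<close>.\<close>
  have match: "sol f t 0 x0 (history (c i)) l = sol f t 0 x0 (history (c i)) \<theta>" if t: "t \<le> clock (c i)" for i t
  proof -
    let ?y = "sol f t 0 x0 (history (c i))"
    have "(\<lambda>j. norm (?y (\<eta> (q j)) - ?y \<theta>)) \<longlonglongrightarrow> norm (?y l - ?y \<theta>)"
      using isCont_tendsto_compose[OF sol_isCont lim] by (intro tendsto_intros) (simp add: o_def)
    moreover have "(\<lambda>j. norm (?y (\<eta> (q j)) - ?y \<theta>)) \<longlonglongrightarrow> 0"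
    proof (rule tendsto_sandwich[OF _ _ tendsto_const mu_q])
      show "\<forall>\<^sub>F j in sequentially. norm (?y (\<eta> (q j)) - ?y \<theta>) \<le> \<mu> (q j)"
        using eventually_ge_at_top[of i]
      proof eventually_elim
        case (elim j)
        then show ?case
          using order_trans[OF output_error_ge[OF t] less_imp_le[OF error_small[OF le_sq]]] by blast
      qed
    qed simp
    ultimately show ?thesis
      using LIMSEQ_unique by fastforce
  qed
  obtain a where a: "0 < a" and expand:
    "\<forall>\<^sub>F \<zeta> in nhds l. a * norm (\<zeta> - l) \<le> output_error f \<theta> x0 (clock (c 0)) (history (c 0)) \<zeta>"
    using output_error_expansive[OF f_differentiable rank[OF l] match] by blast
  have "\<forall>\<^sub>F j in sequentially. a * norm (\<eta> (q j) - l) \<le> output_error f \<theta> x0 (clock (c 0)) (history (c 0)) (\<eta> (q j))"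
    using eventually_compose_filterlim[OF expand lim] by (simp add: o_def)
  moreover have "\<forall>\<^sub>F j in sequentially. inverse (\<kappa> (q j)) < a"
    using order_tendstoD(2)[OF kappa_q a] .
  \<comment> \<open>Expansion puts \<open>a\<close> times the distance below the tolerance; once the
    gain exceeds \<open>1 / a\<close>, the limit \<open>l\<close> lies in the tested ball.\<close>
  ultimately have "\<forall>\<^sub>F j in sequentially. norm (\<eta> (q j) - l) < \<kappa> (q j) * \<mu> (q j)"
  proof eventually_elim
    case (elim j)
    then have "a * norm (\<eta> (q j) - l) < \<mu> (q j)"
      using error_small[of 0 "q j"] by simp
    moreover have "1 < a * \<kappa> (q j)"
      using elim pos(2)[of "q j"] by (simp add: field_simps)
    then have "\<mu> (q j) \<le> a * (\<kappa> (q j) * \<mu> (q j))"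
      using pos(1)[of "q j"] by (simp add: mult.assoc[symmetric])
    ultimately show ?case using a by (meson less_le_trans mult_less_cancel_left_pos)
  qed
  then obtain j where "norm (\<eta> (q j) - l) < \<kappa> (q j) * \<mu> (q j)"
    using eventually_happens by force
  then obtain k where "l \<in> ball (\<eta> k) (\<kappa> k * \<mu> k)"
    by (auto simp: dist_norm)
  moreover define x where "x = sol f (T k) 0 x0 (u k) \<theta>"
  ultimately have "sol f (T k + N k) (T k) x (w k) l \<in> ball (sol f (T k + N k) (T k) x (w k) (\<eta> k)) (\<epsilon> / 2)"
    unfolding x_def by (intro subsetD[OF accepted] imageI)
  then have "dist (sol f (T k + N k) (T k) x (w k) (\<eta> k)) (sol f (T k + N k) (T k) x (w k) l) < \<epsilon> / 2"
    by simp
  moreover have "dist (sol f (T k + N k) (T k) x (w k) (\<eta> k)) xs < \<epsilon> / 2"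
    using Test(4)[of k] by (simp add: x_def dist_norm)
  \<comment> \<open>One half of \<epsilon> comes from the accepted test (c), the other from the plan
    (b).\<close>
  ultimately have "dist (sol f (T k + N k) (T k) x (w k) l) xs < \<epsilon>"
    by (metis dist_commute dist_triangle_half_r)
  \<comment> \<open>Agreement of \<open>l\<close> with \<theta> at time \<open>T k\<close> turns the
    prediction into a solution from time 0; agreement at \<open>T k + N k\<close> identifies its end
    with the actual state.\<close>
  moreover have "sol f (T k + N k) (T k) x (w k) l = sol f (T k + N k) 0 x0 (w k) \<theta>"
  proof -
    have "x = sol f (T k) 0 x0 (w k) \<theta>"
      unfolding x_def using Test(3)[of k] by (intro sol_cong) simp
    also have "\<dots> = sol f (T k) 0 x0 (w k) l"
      using match[of "T k" "Suc (s k)"] by (simp add: outer)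
    finally show ?thesis
      using match[of "T k + N k" "Suc (s k)"] by (simp add: outer sol_append)
  qed
  ultimately show False
    using far[of k] by (simp add: dist_norm)
qed

end

text \<open>Termination under every choice is the absence of infinite runs; the second conjunct
  rules out stopping by deadlock, and the third locates the final state. The clock starts at
  \<open>N0\<close> because the excitation signal has then been applied.\<close>

theorem theorem2:
  fixes f :: "real^'n \<Rightarrow> real^'m \<Rightarrow> real^'p \<Rightarrow> real^'n"
    and \<Omega> :: "(real^'p) set" and \<theta> :: "real^'p"
    and xs x0 :: "real^'n"
    and Nb :: "real^'n \<Rightarrow> nat" and \<rho> :: "real^'n \<Rightarrow> real"
    and \<beta> \<mu>0 \<kappa>0 \<epsilon> :: real
    and N0 :: nat and u0 :: "nat \<Rightarrow> real^'m"
  assumes C1: "C1_map (\<lambda>(x, v, \<xi>). f x v \<xi>)"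
    and Omega: "compact \<Omega>" "convex \<Omega>" "\<theta> \<in> \<Omega>"
    and reachability: "\<forall>x. \<forall>\<xi>\<in>\<Omega>. \<exists>N>0. \<exists>u.
          sol f N 0 x u \<xi> = xs \<and> rank_input_jacobian f N x u \<xi> = CARD('n)"
    and excitation: "\<exists>N u. exciting f \<Omega> N u"
    and bounds: "\<forall>x. Nb x > 0 \<and> \<rho> x > 0 \<and>
          (\<forall>\<xi>\<in>\<Omega>. \<exists>N\<le>Nb x. \<exists>u. (\<forall>t<N. u t \<in> cball 0 (\<rho> x)) \<and> sol f N 0 x u \<xi> = xs)"
    and constants: "0 < \<beta>" "\<beta> < 1" "0 < \<mu>0" "0 < \<kappa>0" "0 < \<epsilon>"
    and signal: "exciting f \<Omega> N0 u0"
  shows "let step = alg_step f \<theta> \<Omega> x0 xs Nb \<rho> \<beta> \<epsilon>;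
             init = Outer N0 u0 \<mu>0 \<kappa>0
         in (\<nexists>c. c 0 = init \<and> (\<forall>i. step (c i) (c (Suc i)))) \<and>
            (\<forall>c. step\<^sup>*\<^sup>* init c \<longrightarrow> (\<exists>T u. c = Halted T u) \<or> (\<exists>c'. step c c')) \<and>
            (\<forall>T u. step\<^sup>*\<^sup>* init (Halted T u) \<longrightarrow> sol f T 0 x0 u \<theta> \<in> ball xs \<epsilon>)"
proof -
  let ?init = "Outer N0 u0 \<mu>0 \<kappa>0"
  have diff: "(\<lambda>(x, v, \<xi>). f x v \<xi>) differentiable (at z)" for z
    using C1 unfolding C1_map_def differentiable_def by blast
  interpret regulation f \<Omega> \<theta> xs x0 Nb \<rho> \<beta> \<epsilon>
    using diff Omega bounds constants by unfold_locales auto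
  have init: "consistent ?init" using constants by simp
  have False if c: "c 0 = ?init" "\<forall>i. step (c i) (c (Suc i))" for c
  proof -
    interpret infinite_run f \<Omega> \<theta> xs x0 Nb \<rho> \<beta> \<epsilon> c
      using c init by unfold_locales auto
    show False
      using no_infinite_run signal c(1) unfolding exciting_def by simp
  qed
  moreover have "(\<exists>T u. c = Halted T u) \<or> (\<exists>c'. step c c')" if "step\<^sup>*\<^sup>* ?init c" for c
    using progress consistent_reachable[OF that init] by blast
  moreover have "sol f T 0 x0 u \<theta> \<in> ball xs \<epsilon>" if "step\<^sup>*\<^sup>* ?init (Halted T u)" for T u
    using consistent_reachable[OF that init] by (simp add: dist_norm norm_minus_commute)
  ultimately show ?thesis unfolding Let_def by blast
qed

end
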